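(* The Min-WCS problem can be solved optimally in $O\!\left(T\prod_{i=1}^{n}(|\mathcal{C}_i|+1)\right)$ time, where $n$ is the number of job chains and $T=\sum_{i=1}^n |\mathcal{C}_i|$.
   Context: Min-WCS problem. Input: a positive integer $n$ and job chains $\mathcal{C}_1,\dots,\mathcal{C}_n$, where $\mathcal{C}_i$ consists of $|\mathcal{C}_i|\geq 1$ jobs $J_i^1 \to \cdots \to J_i^{|\mathcal{C}_i|}$, each job $J_i^j$ having a non-negative weight $w_i^j$; $J_i^{|\mathcal{C}_i|}$ is the leaf job of $\mathcal{C}_i$. Every job has unit processing time and there is one machine. With $T=\sum_i |\mathcal{C}_i|$, a feasible schedule $S$ is a bijection from the set of all jobs to $\{1,\dots,T\}$ with $S(J_i^1)<\cdots<S(J_i^{|\mathcal{C}_i|})$ for all $i$. The objective to minimize is $wcs(S)=\sum_{i,j} w_i^j S(J_i^j) + \sum_{i} S(J_i^{|\mathcal{C}_i|})^2$. *)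

theory Defs
  imports Complex_Main "HOL-Library.Landau_Symbols"
begin

section \<open>The Min-WCS problem\<close>

text \<open>
  An instance is the list of its chains, a chain is the list of the weights of its jobs.
  Chains and the jobs inside a chain are counted from 0, so that the job
  $J_i^j$ is the pair \<open>(i - 1, j - 1)\<close>; time slots are counted from 1.
\<close>

type_synonym wcs_input = "real list list"
type_synonym job = "nat \<times> nat"

definition wcs_instance :: "wcs_input \<Rightarrow> bool" where
  "wcs_instance cs \<longleftrightarrow> cs \<noteq> [] \<and> (\<forall>c \<in> set cs. c \<noteq> [] \<and> (\<forall>w \<in> set c. 0 \<le> w))"

definition jobs :: "wcs_input \<Rightarrow> job set" where
  "jobs cs = {(i, j). i < length cs \<and> j < length (cs ! i)}"

definition num_jobs :: "wcs_input \<Rightarrow> nat" where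
  "num_jobs cs = (\<Sum>i<length cs. length (cs ! i))"

definition feasible :: "wcs_input \<Rightarrow> (job \<Rightarrow> nat) \<Rightarrow> bool" where
  "feasible cs S \<longleftrightarrow>
     bij_betw S (jobs cs) {1..num_jobs cs} \<and>
     (\<forall>i < length cs. \<forall>k < length (cs ! i). \<forall>j < k. S (i, j) < S (i, k))"

definition wcs :: "wcs_input \<Rightarrow> (job \<Rightarrow> nat) \<Rightarrow> real" where
  "wcs cs S =
     (\<Sum>(i, j) \<in> jobs cs. cs ! i ! j * real (S (i, j))) +
     (\<Sum>i<length cs. (real (S (i, length (cs ! i) - 1)))\<^sup>2)"

definition optimal_schedule :: "wcs_input \<Rightarrow> (job \<Rightarrow> nat) \<Rightarrow> bool" where
  "optimal_schedule cs S \<longleftrightarrow> is_arg_min (wcs cs) (feasible cs) S"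


section \<open>A unit-cost real RAM\<close>

text \<open>
  Programs work on named arrays of unbounded length holding natural numbers (used for counters and
  for addressing) or real numbers; a scalar variable is cell 0 of an array. A program mentions only
  finitely many names. Reals cannot be converted to addresses, and the only operations on natural
  numbers are addition, truncated subtraction and comparison. Real constants are restricted
  to natural numbers, so that no information can be hidden in them.
\<close>

type_synonym vname = string

record state =
  nmem :: "vname \<Rightarrow> nat \<Rightarrow> nat"
  rmem :: "vname \<Rightarrow> nat \<Rightarrow> real"

datatype nexp =
    NNum nat
  | NRead vname nexp
  | NPlus nexp nexp
  | NMinus nexp nexp

datatype rexp =
    RNum nat
  | RRead vname nexp
  | RPlus rexp rexp
  | RMinus rexp rexp
  | RTimes rexp rexp

datatype bexp =
    NLess nexp nexp
  | RLess rexp rexp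
  | BNot bexp
  | BAnd bexp bexp

datatype com =
    Skip
  | NWrite vname nexp nexp
  | RWrite vname nexp rexp
  | Seq com com
  | Cond bexp com com
  | While bexp com

fun nval :: "nexp \<Rightarrow> state \<Rightarrow> nat" where
  "nval (NNum k) s = k"
| "nval (NRead x e) s = nmem s x (nval e s)"
| "nval (NPlus e1 e2) s = nval e1 s + nval e2 s"
| "nval (NMinus e1 e2) s = nval e1 s - nval e2 s"

fun rval :: "rexp \<Rightarrow> state \<Rightarrow> real" where
  "rval (RNum k) s = real k"
| "rval (RRead x e) s = rmem s x (nval e s)"
| "rval (RPlus e1 e2) s = rval e1 s + rval e2 s"
| "rval (RMinus e1 e2) s = rval e1 s - rval e2 s"
| "rval (RTimes e1 e2) s = rval e1 s * rval e2 s"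

fun bval :: "bexp \<Rightarrow> state \<Rightarrow> bool" where
  "bval (NLess e1 e2) s \<longleftrightarrow> nval e1 s < nval e2 s"
| "bval (RLess e1 e2) s \<longleftrightarrow> rval e1 s < rval e2 s"
| "bval (BNot b) s \<longleftrightarrow> \<not> bval b s"
| "bval (BAnd b1 b2) s \<longleftrightarrow> bval b1 s \<and> bval b2 s"

text \<open>Every constant, memory access, arithmetic operation, comparison and connective costs 1.\<close>

fun ncost :: "nexp \<Rightarrow> nat" where
  "ncost (NNum k) = 1"
| "ncost (NRead x e) = 1 + ncost e"
| "ncost (NPlus e1 e2) = 1 + ncost e1 + ncost e2"
| "ncost (NMinus e1 e2) = 1 + ncost e1 + ncost e2"

fun rcost :: "rexp \<Rightarrow> nat" where
  "rcost (RNum k) = 1"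
| "rcost (RRead x e) = 1 + ncost e"
| "rcost (RPlus e1 e2) = 1 + rcost e1 + rcost e2"
| "rcost (RMinus e1 e2) = 1 + rcost e1 + rcost e2"
| "rcost (RTimes e1 e2) = 1 + rcost e1 + rcost e2"

fun bcost :: "bexp \<Rightarrow> nat" where
  "bcost (NLess e1 e2) = 1 + ncost e1 + ncost e2"
| "bcost (RLess e1 e2) = 1 + rcost e1 + rcost e2"
| "bcost (BNot b) = 1 + bcost b"
| "bcost (BAnd b1 b2) = 1 + bcost b1 + bcost b2"

definition nstore :: "vname \<Rightarrow> nat \<Rightarrow> nat \<Rightarrow> state \<Rightarrow> state" where
  "nstore x a v s = s\<lparr>nmem := (nmem s)(x := (nmem s x)(a := v))\<rparr>"

definition rstore :: "vname \<Rightarrow> nat \<Rightarrow> real \<Rightarrow> state \<Rightarrow> state" where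
  "rstore x a v s = s\<lparr>rmem := (rmem s)(x := (rmem s x)(a := v))\<rparr>"

text \<open>
  \<open>exec c s t s'\<close>: started in state \<open>s\<close>, the program \<open>c\<close> terminates in state \<open>s'\<close>
  after exactly \<open>t\<close> time units.
\<close>

inductive exec :: "com \<Rightarrow> state \<Rightarrow> nat \<Rightarrow> state \<Rightarrow> bool" where
  Skip: "exec Skip s 1 s"
| NWrite: "exec (NWrite x a e) s (1 + ncost a + ncost e) (nstore x (nval a s) (nval e s) s)"
| RWrite: "exec (RWrite x a e) s (1 + ncost a + rcost e) (rstore x (nval a s) (rval e s) s)"
| Seq: "exec c1 s t1 s' \<Longrightarrow> exec c2 s' t2 s'' \<Longrightarrow> exec (Seq c1 c2) s (t1 + t2) s''"
| CondTrue: "bval b s \<Longrightarrow> exec c1 s t s' \<Longrightarrow> exec (Cond b c1 c2) s (1 + bcost b + t) s'"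
| CondFalse: "\<not> bval b s \<Longrightarrow> exec c2 s t s' \<Longrightarrow> exec (Cond b c1 c2) s (1 + bcost b + t) s'"
| WhileFalse: "\<not> bval b s \<Longrightarrow> exec (While b c) s (1 + bcost b) s"
| WhileTrue: "bval b s \<Longrightarrow> exec c s t1 s' \<Longrightarrow> exec (While b c) s' t2 s'' \<Longrightarrow>
    exec (While b c) s (1 + bcost b + t1 + t2) s''"

lemma exec_deterministic:
  "exec c s t s' \<Longrightarrow> exec c s t' s'' \<Longrightarrow> t' = t \<and> s'' = s'"
proof (induction arbitrary: t' s'' rule: exec.induct)
  case (Seq c1 s t1 s1 c2 t2 s2)
  from Seq.prems Seq.IH show ?case by (cases rule: exec.cases) blast+
next
  case (WhileTrue b s c t1 s1 t2 s2)
  from WhileTrue.prems WhileTrue.hyps WhileTrue.IH show ?case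
    by (cases rule: exec.cases) blast+
next
  case (CondTrue b s c1 t s1 c2)
  from CondTrue.prems CondTrue.hyps CondTrue.IH show ?case by (cases rule: exec.cases) blast+
next
  case (CondFalse b s c2 t s1 c1)
  from CondFalse.prems CondFalse.hyps CondFalse.IH show ?case by (cases rule: exec.cases) blast+
qed (auto elim: exec.cases)


section \<open>Solving Min-WCS on the machine\<close>

text \<open>
  The jobs are stored consecutively, chain after chain. All memory outside the input is 0.
\<close>

definition job_address :: "wcs_input \<Rightarrow> job \<Rightarrow> nat" where
  "job_address cs = (\<lambda>(i, j). (\<Sum>l<i. length (cs ! l)) + j)"

definition input_state :: "wcs_input \<Rightarrow> state" where
  "input_state cs =
     \<lparr>nmem = (\<lambda>x a.
        if x = ''n'' \<and> a = 0 then length cs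
        else if x = ''len'' \<and> a < length cs then length (cs ! a)
        else 0),
      rmem = (\<lambda>x a.
        if x = ''w'' \<and> a < length (concat cs) then concat cs ! a
        else 0)\<rparr>"

definition output_schedule :: "wcs_input \<Rightarrow> state \<Rightarrow> job \<Rightarrow> nat" where
  "output_schedule cs s J = nmem s ''S'' (job_address cs J)"

definition solves_min_wcs :: "com \<Rightarrow> (wcs_input \<Rightarrow> nat) \<Rightarrow> bool" where
  "solves_min_wcs c time \<longleftrightarrow>
     (\<forall>cs. wcs_instance cs \<longrightarrow>
        (\<exists>s. exec c (input_state cs) (time cs) s \<and> optimal_schedule cs (output_schedule cs s)))"

end

theory Submission imports Defs begin

text \<open>
  Dynamic programming over the sets consisting of the first \<open>k i\<close> jobs of every chain \<open>i\<close>, of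
  which there are \<open>\<Prod>i (|C i| + 1)\<close>. In a schedule of such a set the job in the last slot
  \<open>\<Sum>i k i\<close> is the last job taken from some chain, which gives a Bellman equation with at most \<open>n\<close>
  alternatives. The sets are numbered in mixed radix, so that a predecessor is found by subtracting
  a stride and the vectors \<open>k\<close> are enumerated by a counter whose increment costs \<open>O(n)\<close>. Every table
  entry thus takes time \<open>O(n)\<close>, where \<open>n \<le> T\<close>, and an optimal schedule is read off backwards from the
  recorded choices.
\<close>

section \<open>Reasoning about programs with time bounds\<close>

text \<open>Total correctness with an upper time bound. Exact times would depend on the branches
  taken; bounds compose by addition.\<close>

definition runs_in :: "com \<Rightarrow> nat \<Rightarrow> state \<Rightarrow> (state \<Rightarrow> bool) \<Rightarrow> bool" where
  "runs_in c B s Q \<longleftrightarrow> (\<exists>t s'. exec c s t s' \<and> t \<le> B \<and> Q s')"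

lemma runs_in_weaken:
  assumes "runs_in c B s Q" "\<And>s'. Q s' \<Longrightarrow> Q' s'" "B \<le> B'"
  shows "runs_in c B' s Q'"
  using assms unfolding runs_in_def by (meson order_trans)

lemma runs_in_Seq:
  assumes "runs_in c1 B1 s R" "\<And>s'. R s' \<Longrightarrow> runs_in c2 B2 s' Q"
  shows "runs_in (Seq c1 c2) (B1 + B2) s Q"
  using assms unfolding runs_in_def by (meson exec.Seq add_mono)

text \<open>The variant drops in every round, so it bounds the number of rounds; the last summand
  pays for the failing guard test.\<close>

lemma runs_in_While:
  fixes variant :: "state \<Rightarrow> nat"
  assumes "I s"
    and step: "\<And>s. I s \<Longrightarrow> bval b s \<Longrightarrow> runs_in c B s (\<lambda>s'. I s' \<and> variant s' < variant s)"
    and exit: "\<And>s. I s \<Longrightarrow> \<not> bval b s \<Longrightarrow> Q s"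
  shows "runs_in (While b c) (variant s * (1 + bcost b + B) + (1 + bcost b)) s Q"
  using \<open>I s\<close>
proof (induction "variant s" arbitrary: s rule: less_induct)
  case less
  show ?case
  proof (cases "bval b s")
    case False
    then show ?thesis
      using exec.WhileFalse[of b s c] exit[OF less.prems] unfolding runs_in_def
      by (intro exI[of _ "1 + bcost b"] exI[of _ s]) auto
  next
    case True
    then obtain t1 s1 where 1: "exec c s t1 s1" "t1 \<le> B" "I s1" "variant s1 < variant s"
      using step[OF less.prems] unfolding runs_in_def by blast
    then obtain t2 s2 where 2: "exec (While b c) s1 t2 s2" "Q s2"
      "t2 \<le> variant s1 * (1 + bcost b + B) + (1 + bcost b)"
      using less.hyps unfolding runs_in_def by blast
    have "Suc (variant s1) * (1 + bcost b + B) \<le> variant s * (1 + bcost b + B)"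
      using 1(4) by (intro mult_right_mono) auto
    then have "1 + bcost b + t1 + t2 \<le> variant s * (1 + bcost b + B) + (1 + bcost b)"
      using 1(2) 2(3) by simp
    then show ?thesis
      using exec.WhileTrue[OF True 1(1) 2(1)] 2(2) unfolding runs_in_def by blast
  qed
qed

fun loop_free :: "com \<Rightarrow> bool" where
  "loop_free (Seq c1 c2) \<longleftrightarrow> loop_free c1 \<and> loop_free c2"
| "loop_free (Cond b c1 c2) \<longleftrightarrow> loop_free c1 \<and> loop_free c2"
| "loop_free (While b c) \<longleftrightarrow> False"
| "loop_free _ \<longleftrightarrow> True"

text \<open>A functional interpreter that simplification can evaluate symbolically. It agrees with
  \<open>exec\<close> on \<open>loop_free\<close> programs; its value on \<open>While\<close> is
  only a default.\<close>

fun run :: "com \<Rightarrow> state \<Rightarrow> state" where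
  "run (NWrite x a e) s = nstore x (nval a s) (nval e s) s"
| "run (RWrite x a e) s = rstore x (nval a s) (rval e s) s"
| "run (Seq c1 c2) s = run c2 (run c1 s)"
| "run (Cond b c1 c2) s = (if bval b s then run c1 s else run c2 s)"
| "run _ s = s"

fun max_time :: "com \<Rightarrow> nat" where
  "max_time (NWrite x a e) = 1 + ncost a + ncost e"
| "max_time (RWrite x a e) = 1 + ncost a + rcost e"
| "max_time (Seq c1 c2) = max_time c1 + max_time c2"
| "max_time (Cond b c1 c2) = 1 + bcost b + max (max_time c1) (max_time c2)"
| "max_time _ = 1"

text \<open>Replaces the state-dependent number of rounds by a fixed \<open>N\<close>, so that time
  bounds mention only the instance; \<open>Suc\<close> covers the final test.\<close>

lemma runs_in_While_bound:
  fixes variant :: "state \<Rightarrow> nat"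
  assumes "I s" "variant s \<le> N" "1 + bcost b + B \<le> D"
    and "\<And>s. I s \<Longrightarrow> bval b s \<Longrightarrow> runs_in c B s (\<lambda>s'. I s' \<and> variant s' < variant s)"
    and "\<And>s. I s \<Longrightarrow> \<not> bval b s \<Longrightarrow> Q s"
  shows "runs_in (While b c) (Suc N * D) s Q"
proof (rule runs_in_weaken)
  show "runs_in (While b c) (variant s * (1 + bcost b + B) + (1 + bcost b)) s Q"
    using assms by (intro runs_in_While[of I]) auto
  have "variant s * (1 + bcost b + B) \<le> N * D" using assms by (intro mult_mono) auto
  then show "variant s * (1 + bcost b + B) + (1 + bcost b) \<le> Suc N * D" using assms(3) by simp
qed

lemma exec_loop_free:
  "loop_free c \<Longrightarrow> \<exists>t \<le> max_time c. exec c s t (run c s)"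
proof (induction c arbitrary: s)
  case (Seq c1 c2)
  then obtain t1 t2 where "t1 \<le> max_time c1" "exec c1 s t1 (run c1 s)"
    "t2 \<le> max_time c2" "exec c2 (run c1 s) t2 (run c2 (run c1 s))"
    by fastforce
  then show ?case using exec.Seq by (intro exI[of _ "t1 + t2"]) auto
next
  case (Cond b c1 c2)
  then obtain t1 t2 where "t1 \<le> max_time c1" "exec c1 s t1 (run c1 s)"
    "t2 \<le> max_time c2" "exec c2 s t2 (run c2 s)"
    by fastforce
  then show ?case
    using exec.CondTrue[of b s c1 t1 "run c1 s" c2] exec.CondFalse[of b s c2 t2 "run c2 s" c1]
    by (intro exI[of _ "1 + bcost b + (if bval b s then t1 else t2)"]) auto
qed (auto intro: exec.Skip[simplified] exec.NWrite[simplified] exec.RWrite[simplified])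

lemma runs_in_loop_free:
  "loop_free c \<Longrightarrow> max_time c \<le> B \<Longrightarrow> Q (run c s) \<Longrightarrow> runs_in c B s Q"
  using exec_loop_free order_trans unfolding runs_in_def by blast

lemma nmem_store [simp]:
  "nmem (nstore x a v s) = (nmem s)(x := (nmem s x)(a := v))"
  "nmem (rstore x a r s) = nmem s"
  by (simp_all add: nstore_def rstore_def)

lemma rmem_store [simp]:
  "rmem (rstore x a r s) = (rmem s)(x := (rmem s x)(a := r))"
  "rmem (nstore x a v s) = rmem s"
  by (simp_all add: nstore_def rstore_def)


section \<open>The dynamic program\<close>

lemma nth_concat_offset:
  assumes "i < length xss" "j < length (xss ! i)"
  shows "(\<Sum>l<i. length (xss ! l)) + j < length (concat xss)"
    and "concat xss ! ((\<Sum>l<i. length (xss ! l)) + j) = xss ! i ! j"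
proof -
  have "(\<Sum>l<i. length (xss ! l)) + j < length (concat xss) \<and>
      concat xss ! ((\<Sum>l<i. length (xss ! l)) + j) = xss ! i ! j"
    using assms
  proof (induction xss arbitrary: i)
    case (Cons xs xss)
    then show ?case
      by (cases i) (simp_all add: sum.lessThan_Suc_shift nth_append add.assoc del: sum.lessThan_Suc)
  qed simp
  then show "(\<Sum>l<i. length (xss ! l)) + j < length (concat xss)"
    and "concat xss ! ((\<Sum>l<i. length (xss ! l)) + j) = xss ! i ! j" by simp_all
qed

text \<open>Both sides are written with additions because the sums in question are over naturals,
  where subtraction truncates.\<close>

lemma sum_fun_upd:
  fixes f :: "'a \<Rightarrow> 'b \<Rightarrow> 'c::comm_monoid_add"
  assumes "finite A" "i \<in> A"
  shows "(\<Sum>l\<in>A. f l ((k(i := v)) l)) + f i (k i) = (\<Sum>l\<in>A. f l (k l)) + f i v"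
  using assms by (simp add: sum.remove[of A i] ac_simps)

locale min_wcs =
  fixes cs :: wcs_input
  assumes inst: "wcs_instance cs"
begin

abbreviation n :: nat where "n \<equiv> length cs"
abbreviation L :: "nat \<Rightarrow> nat" where "L i \<equiv> length (cs ! i)"

text \<open>\<open>offset i\<close> is the address of job \<open>(i, 0)\<close>;
  \<open>stride i\<close> is the place value of digit \<open>i\<close>, and \<open>stride n\<close>
  the number of codes.\<close>

definition offset :: "nat \<Rightarrow> nat" where "offset i = (\<Sum>l<i. L l)"
definition stride :: "nat \<Rightarrow> nat" where "stride i = (\<Prod>l<i. L l + 1)"

text \<open>
  A vector \<open>k\<close> stands for the set of the first \<open>k i\<close> jobs of every chain \<open>i\<close>; its code is the
  number with mixed-radix digits \<open>k 0, \<dots>, k (n - 1)\<close>.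
\<close>

definition valid :: "(nat \<Rightarrow> nat) \<Rightarrow> bool" where "valid k \<longleftrightarrow> (\<forall>i<n. k i \<le> L i)"
definition code :: "(nat \<Rightarrow> nat) \<Rightarrow> nat" where "code k = (\<Sum>i<n. k i * stride i)"
definition weight :: "(nat \<Rightarrow> nat) \<Rightarrow> nat" where "weight k = (\<Sum>i<n. k i)"
definition prefix :: "(nat \<Rightarrow> nat) \<Rightarrow> job set" where "prefix k = {(i, j). i < n \<and> j < k i}"
definition suffix :: "(nat \<Rightarrow> nat) \<Rightarrow> job set" where
  "suffix k = {(i, j). i < n \<and> k i \<le> j \<and> j < L i}"

text \<open>The share of a single job in the objective when it occupies slot \<open>t\<close>; the
  squared slot is charged to the leaf.\<close>

definition cost :: "job \<Rightarrow> nat \<Rightarrow> real" where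
  "cost = (\<lambda>(i, j) t. cs ! i ! j * real t + (if Suc j = L i then real t * real t else 0))"

text \<open>The candidate in the Bellman equation: the last job taken from chain \<open>i\<close>
  occupies the last slot \<open>weight k\<close>, and the rest is looked up at the code of
  \<open>k\<close> with digit \<open>i\<close> lowered by 1.\<close>

definition extend :: "(nat \<Rightarrow> real) \<Rightarrow> (nat \<Rightarrow> nat) \<Rightarrow> nat \<Rightarrow> real" where
  "extend V k i = V (code k - stride i) + cost (i, k i - 1) (weight k)"

text \<open>
  \<open>V\<close> and \<open>ch\<close> are tables indexed by codes; an entry \<open>Suc i\<close> of \<open>ch\<close> says that an optimal
  schedule of \<open>prefix k\<close> ends with a job of chain \<open>i\<close>, and 0 that no choice has been made yet.
\<close>

definition bellman :: "(nat \<Rightarrow> real) \<Rightarrow> (nat \<Rightarrow> nat) \<Rightarrow> (nat \<Rightarrow> nat) \<Rightarrow> bool" where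
  "bellman V ch k \<longleftrightarrow>
     (\<exists>i<n. ch (code k) = Suc i \<and> 0 < k i \<and> V (code k) = extend V k i) \<and>
     (\<forall>i<n. 0 < k i \<longrightarrow> V (code k) \<le> extend V k i)"

text \<open>Entry 0 is the base case of the empty set. Zero choices beyond \<open>c\<close> tell the
  next round that its entry has no candidate yet.\<close>

definition tabulated :: "(nat \<Rightarrow> real) \<Rightarrow> (nat \<Rightarrow> nat) \<Rightarrow> nat \<Rightarrow> bool" where
  "tabulated V ch c \<longleftrightarrow> V 0 = 0 \<and> (\<forall>k. valid k \<and> 0 < code k \<and> code k \<le> c \<longrightarrow> bellman V ch k) \<and>
     (\<forall>a>c. ch a = 0)"

section \<open>Addresses, strides and mixed-radix codes\<close>

lemma n_pos: "0 < n"
  using inst by (simp add: wcs_instance_def)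

lemma L_pos: "i < n \<Longrightarrow> 0 < L i"
  using inst by (simp add: wcs_instance_def)

lemma num_jobs_offset: "num_jobs cs = offset n"
  by (simp add: num_jobs_def offset_def)

lemma offset_simps [simp]: "offset 0 = 0" "offset (Suc i) = offset i + L i"
  by (simp_all add: offset_def)

lemma stride_simps [simp]: "stride 0 = 1" "stride (Suc i) = stride i * Suc (L i)"
  by (simp_all add: stride_def)

lemma stride_pos: "0 < stride i"
  by (simp add: stride_def prod_pos)

lemma offset_mono: "i \<le> i' \<Longrightarrow> offset i \<le> offset i'"
  unfolding offset_def by (intro sum_mono2) auto

lemma offset_add_less: "i < i' \<Longrightarrow> j < L i \<Longrightarrow> offset i + j < offset i'"
  using offset_mono[of "Suc i" i'] by simp

lemma offset_add_inject:
  assumes "j < L i" "j' < L i'"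
  shows "offset i + j = offset i' + j' \<longleftrightarrow> i = i' \<and> j = j'"
  using offset_add_less[OF _ assms(1), of i'] offset_add_less[OF _ assms(2), of i]
  by (cases i i' rule: linorder_cases) auto

lemma n_le_num_jobs: "n \<le> num_jobs cs"
proof -
  have "(\<Sum>i<n. 1) \<le> (\<Sum>i<n. L i)"
    by (intro sum_mono) (use L_pos in \<open>simp add: Suc_le_eq\<close>)
  then show ?thesis by (simp add: num_jobs_def)
qed

lemma num_jobs_pos: "0 < num_jobs cs"
  using n_pos n_le_num_jobs by linarith

text \<open>No chain is empty, so every factor is at least 2 and the product is at least
  \<open>2 ^ n\<close>. This absorbs the setup time into the final bound.\<close>

lemma n_le_stride: "n \<le> stride n"
proof -
  have "(\<Prod>i<n. 2) \<le> (\<Prod>i<n. L i + 1)"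
    by (intro prod_mono) (use L_pos in \<open>simp add: Suc_le_eq\<close>)
  then show ?thesis by (simp add: stride_def order_trans[OF less_imp_le[OF less_exp]])
qed

text \<open>The top digit adds at most \<open>L m * stride m\<close> to a remainder below
  \<open>stride m\<close>.\<close>

lemma digits_less_stride:
  assumes "\<forall>i<m. k i \<le> L i"
  shows "(\<Sum>i<m. k i * stride i) < stride m"
  using assms
proof (induction m)
  case (Suc m)
  then have "(\<Sum>i<m. k i * stride i) + k m * stride m < stride m + L m * stride m"
    by (intro add_less_le_mono) auto
  then show ?case by (simp add: algebra_simps)
qed simp

lemma digits_inject:
  assumes "\<forall>i<m. k i \<le> L i" "\<forall>i<m. k' i \<le> L i"
    and "(\<Sum>i<m. k i * stride i) = (\<Sum>i<m. k' i * stride i)"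
  shows "\<forall>i<m. k i = k' i"
  using assms
proof (induction m)
  case (Suc m)
  let ?a = "\<Sum>i<m. k i * stride i" and ?b = "\<Sum>i<m. k' i * stride i"
  have less: "?a < stride m" "?b < stride m"
    using Suc.prems by (auto intro!: digits_less_stride)
  have eq: "?a + k m * stride m = ?b + k' m * stride m"
    using Suc.prems(3) by simp
  \<comment> \<open>The lower digits contribute less than \<open>stride m\<close>, so division
    recovers the top digit.\<close>
  have "(?a + k m * stride m) div stride m = k m" "(?b + k' m * stride m) div stride m = k' m"
    using less stride_pos[of m] by (simp_all add: div_mult_self3)
  then have "k m = k' m" using eq by metis
  moreover from this have "?a = ?b" using eq by simp
  then have "\<forall>i<m. k i = k' i"
    using Suc.prems(1,2) by (intro Suc.IH) auto
  ultimately show ?case by (simp add: less_Suc_eq)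
qed simp

lemma code_less: "valid k \<Longrightarrow> code k < stride n"
  by (simp add: valid_def code_def digits_less_stride)

lemma code_inject: "valid k \<Longrightarrow> valid k' \<Longrightarrow> code k = code k' \<Longrightarrow> i < n \<Longrightarrow> k i = k' i"
  using digits_inject[of n k k'] unfolding valid_def code_def by blast

text \<open>The full vector has the largest code; the sum telescopes since
  \<open>stride (Suc i) = stride i + L i * stride i\<close>.\<close>

lemma code_full: "Suc (code L) = stride n"
proof -
  have "Suc (\<Sum>i<m. L i * stride i) = stride m" for m
    by (induction m) (simp_all add: algebra_simps)
  then show ?thesis by (simp add: code_def)
qed

lemma weight_full: "weight L = num_jobs cs"
  by (simp add: weight_def num_jobs_def)

lemma code_upd: "i < n \<Longrightarrow> code (k(i := v)) + k i * stride i = code k + v * stride i"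
  unfolding code_def using sum_fun_upd[of "{..<n}" i "\<lambda>l x. x * stride l" k v] by simp

lemma weight_upd: "i < n \<Longrightarrow> weight (k(i := v)) + k i = weight k + v"
  unfolding weight_def using sum_fun_upd[of "{..<n}" i "\<lambda>l x. x" k v] by simp

lemma digit_le_code: "i < n \<Longrightarrow> k i * stride i \<le> code k"
  unfolding code_def by (rule member_le_sum) auto

lemma stride_le_code: "i < n \<Longrightarrow> 0 < k i \<Longrightarrow> stride i \<le> code k"
  using digit_le_code[of i k] by (cases "k i") auto

lemma code_decrement:
  assumes "i < n" "0 < k i"
  shows "code (k(i := k i - 1)) = code k - stride i"
  using code_upd[OF assms(1), of k "k i - 1"] assms stride_le_code[of i k]
  by (cases "k i") auto

lemma weight_decrement:
  assumes "i < n" "0 < k i"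
  shows "Suc (weight (k(i := k i - 1))) = weight k"
  using weight_upd[OF assms(1), of k "k i - 1"] assms by simp

lemma valid_decrement: "valid k \<Longrightarrow> valid (k(i := k i - 1))"
  unfolding valid_def by (auto simp: le_diff_conv trans_le_add1)

lemma weight_le: "valid k \<Longrightarrow> weight k \<le> num_jobs cs"
  unfolding weight_def num_jobs_def valid_def by (intro sum_mono) auto

lemma weight_cong: "(\<And>i. i < n \<Longrightarrow> k i = k' i) \<Longrightarrow> weight k = weight k'"
  by (simp add: weight_def)

lemma code_eq_0_iff: "code k = 0 \<longleftrightarrow> weight k = 0"
  by (simp add: code_def weight_def stride_pos[THEN less_imp_neq, symmetric])

text \<open>Strides are positive, so a candidate reads only an entry with a strictly smaller code.
  Overwriting the entry of \<open>k\<close> does not change it.\<close>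

lemma extend_cong:
  assumes "i < n" "0 < k i" "\<And>a. a < code k \<Longrightarrow> V a = V' a"
  shows "extend V k i = extend V' k i"
  using assms stride_pos[of i] stride_le_code[of i k] by (simp add: extend_def)

text \<open>The equation at \<open>k\<close> looks at no code above \<open>code k\<close>, so
  finished entries stay correct while the table grows.\<close>

lemma bellman_cong:
  assumes "\<And>a. a \<le> code k \<Longrightarrow> V a = V' a" "ch (code k) = ch' (code k)" "bellman V ch k"
  shows "bellman V' ch' k"
proof -
  have "extend V k i = extend V' k i" if "i < n" "0 < k i" for i
    using extend_cong[of i k V V', OF that] assms(1) by simp
  then show ?thesis using assms unfolding bellman_def by auto
qed

section \<open>Prefixes, suffixes and the objective as a sum over jobs\<close>

lemma prefix_decrement:
  assumes "i < n" "0 < k i"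
  shows "prefix k = insert (i, k i - 1) (prefix (k(i := k i - 1)))"
    and "(i, k i - 1) \<notin> prefix (k(i := k i - 1))"
  using assms by (auto simp: prefix_def split: if_splits)

lemma suffix_decrement:
  assumes "i < n" "0 < k i" "valid k"
  shows "suffix (k(i := k i - 1)) = insert (i, k i - 1) (suffix k)"
    and "(i, k i - 1) \<notin> suffix k"
proof -
  have "k i \<le> L i" using assms by (simp add: valid_def)
  then show "suffix (k(i := k i - 1)) = insert (i, k i - 1) (suffix k)"
    using assms(1,2) by (auto simp: suffix_def split: if_splits)
  show "(i, k i - 1) \<notin> suffix k"
    using assms(2) by (auto simp: suffix_def)
qed

lemma finite_prefix: "finite (prefix k)"
proof -
  have "prefix k = Sigma {..<n} (\<lambda>i. {..<k i})" by (auto simp: prefix_def)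
  then show ?thesis by simp
qed

lemma jobs_eq_prefix: "jobs cs = prefix L"
  by (simp add: jobs_def prefix_def)

lemma finite_suffix: "finite (suffix k)"
  by (rule finite_subset[OF _ finite_prefix[of L]]) (auto simp: suffix_def prefix_def)

lemma card_jobs: "card (jobs cs) = num_jobs cs"
proof -
  have "jobs cs = Sigma {..<n} (\<lambda>i. {..<L i})" by (auto simp: jobs_def)
  then show ?thesis by (simp add: num_jobs_def)
qed

text \<open>Chains are nonempty, so the leaf test in \<open>cost\<close> selects exactly one job per
  chain and yields the quadratic part.\<close>

lemma wcs_eq_sum_cost: "wcs cs S = (\<Sum>p\<in>jobs cs. cost p (S p))"
proof -
  have jobs: "jobs cs = Sigma {..<n} (\<lambda>i. {..<L i})" by (auto simp: jobs_def)
  have leaf: "(\<Sum>j<L i. if Suc j = L i then real (S (i, j)) * real (S (i, j)) else 0)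
      = (real (S (i, L i - 1)))\<^sup>2" if "i < n" for i
  proof -
    have "(\<Sum>j<L i. if Suc j = L i then real (S (i, j)) * real (S (i, j)) else 0)
        = (\<Sum>j<L i. if j = L i - 1 then (real (S (i, j)))\<^sup>2 else 0)"
      by (intro sum.cong) (auto simp: power2_eq_square)
    then show ?thesis using L_pos[OF that] by simp
  qed
  have "(\<Sum>p\<in>jobs cs. cost p (S p)) = (\<Sum>(i, j)\<in>jobs cs. cs ! i ! j * real (S (i, j))) +
      (\<Sum>(i, j)\<in>jobs cs. if Suc j = L i then real (S (i, j)) * real (S (i, j)) else 0)"
    unfolding sum.distrib[symmetric] by (intro sum.cong) (auto simp: cost_def)
  also have "(\<Sum>(i, j)\<in>jobs cs. if Suc j = L i then real (S (i, j)) * real (S (i, j)) else 0)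
      = (\<Sum>i<n. (real (S (i, L i - 1)))\<^sup>2)"
    unfolding jobs by (subst sum.Sigma[symmetric]) (auto intro!: sum.cong simp: leaf simp del: One_nat_def)
  finally show ?thesis by (simp add: wcs_def)
qed

text \<open>
  Monotonicity forces the job in the last slot to be \<open>(i, k i - 1)\<close> for some \<open>i\<close>; removing it is
  the induction step.
\<close>

lemma table_lower_bound:
  assumes tab: "tabulated V ch (code L)" and "valid k"
    and "bij_betw S (prefix k) {1..weight k}"
    and "\<And>i j j'. i < n \<Longrightarrow> j < j' \<Longrightarrow> j' < k i \<Longrightarrow> S (i, j) < S (i, j')"
  shows "V (code k) \<le> (\<Sum>p\<in>prefix k. cost p (S p))"
  using assms(2-)
proof (induction "weight k" arbitrary: k)
  case 0
  then have "prefix k = {}" by (auto simp: prefix_def weight_def)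
  then show ?case using 0 code_eq_0_iff[of k] tab by (simp add: tabulated_def)
next
  case (Suc m)
  have "weight k \<in> S ` prefix k"
    using Suc.prems(2) Suc.hyps(2) by (simp add: bij_betw_def)
  then obtain i j where ij: "i < n" "j < k i" "S (i, j) = weight k"
    by (auto simp: prefix_def)
  have range: "S p \<le> weight k" if "p \<in> prefix k" for p
    using Suc.prems(2) that by (auto simp: bij_betw_def)
  have j: "j = k i - 1"
  proof (rule ccontr)
    \<comment> \<open>Otherwise a later job of the same chain would lie beyond the last
      slot.\<close>
    assume "j \<noteq> k i - 1"
    then have "S (i, j) < S (i, k i - 1)" using ij by (intro Suc.prems(3)) auto
    then show False using ij range[of "(i, k i - 1)"] by (simp add: prefix_def)
  qed
  define k' where "k' = k(i := k i - 1)"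
  have pos: "0 < k i" using ij by simp
  note pre = prefix_decrement[of i k, OF ij(1) pos, folded k'_def]
  have wt: "Suc (weight k') = weight k"
    using weight_decrement[of i k, OF ij(1) pos] by (simp add: k'_def)
  have "bij_betw S (prefix k') ({1..weight k} - {weight k})"
  proof -
    have "prefix k' = prefix k - {(i, k i - 1)}" using pre by auto
    then show ?thesis
      using bij_betw_DiffI[OF Suc.prems(2), of "{(i, k i - 1)}" "{weight k}"] ij j pre wt
      by (simp add: bij_betw_def)
  qed
  moreover have "{1..weight k} - {weight k} = {1..weight k'}" using wt by auto
  ultimately have "V (code k') \<le> (\<Sum>p\<in>prefix k'. cost p (S p))"
    using Suc.prems(3) Suc.hyps(2) wt valid_decrement[OF Suc.prems(1)]
    by (intro Suc.hyps(1)) (auto simp: k'_def split: if_splits)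
  \<comment> \<open>A valid vector has a code at most \<open>code L\<close>, and positive weight
    makes its code positive, so the table covers it.\<close>
  moreover have "bellman V ch k"
    using tab Suc.prems(1) Suc.hyps(2) code_eq_0_iff[of k] code_less[OF Suc.prems(1)] code_full
    unfolding tabulated_def by auto
  then have "V (code k) \<le> extend V k i"
    using ij pos by (simp add: bellman_def)
  moreover have "extend V k i = V (code k') + cost (i, j) (S (i, j))"
    using code_decrement[of i k, OF ij(1) pos] ij(3) by (simp add: extend_def k'_def j)
  moreover have "(\<Sum>p\<in>prefix k. cost p (S p))
      = cost (i, j) (S (i, j)) + (\<Sum>p\<in>prefix k'. cost p (S p))"
    using pre finite_prefix[of k'] by (simp add: j)
  ultimately show ?case by linarith
qed

end

section \<open>The program\<close>

abbreviation var :: "vname \<Rightarrow> nexp" where "var x \<equiv> NRead x (NNum 0)"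
abbreviation set_var :: "vname \<Rightarrow> nexp \<Rightarrow> com" where "set_var x \<equiv> NWrite x (NNum 0)"
abbreviation incr :: "vname \<Rightarrow> com" where "incr x \<equiv> set_var x (NPlus (var x) (NNum 1))"
abbreviation cur :: "vname \<Rightarrow> nexp" where "cur x \<equiv> NRead x (var ''i'')"
abbreviation nxt :: "vname \<Rightarrow> nexp" where "nxt x \<equiv> NRead x (NPlus (var ''i'') (NNum 1))"
abbreviation set_nxt :: "vname \<Rightarrow> nexp \<Rightarrow> com" where
  "set_nxt x \<equiv> NWrite x (NPlus (var ''i'') (NNum 1))"

text \<open>The machine cannot convert naturals to reals, hence the table \<open>R\<close> with \<open>R[v] = v\<close>.\<close>

definition setup_job :: com where
  "setup_job =
     Seq (set_nxt ''str'' (NPlus (nxt ''str'') (cur ''str'')))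
    (Seq (RWrite ''R'' (NPlus (nxt ''off'') (NNum 1)) (RPlus (RRead ''R'' (nxt ''off'')) (RNum 1)))
    (Seq (set_nxt ''off'' (NPlus (nxt ''off'') (NNum 1)))
         (incr ''j'')))"

text \<open>Naturals cannot be multiplied: entry \<open>i + 1\<close> of \<open>str\<close> starts
  as the stride of \<open>i\<close>, and each job adds that stride once more, which gives the factor
  \<open>Suc (L i)\<close>. Likewise each job moves the next offset by 1.\<close>

definition setup_chain :: com where
  "setup_chain =
     Seq (Seq (set_var ''j'' (NNum 0)) (Seq (set_nxt ''str'' (cur ''str'')) (set_nxt ''off'' (cur ''off''))))
    (Seq (While (NLess (var ''j'') (cur ''len'')) setup_job)
         (incr ''i''))"

definition setup_tables :: com where
  "setup_tables =
     Seq (NWrite ''str'' (NNum 0) (NNum 1))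
         (While (NLess (var ''i'') (var ''n'')) setup_chain)"

text \<open>\<open>c\<close> is left alone: all resets together with the final digit increment raise
  the code by exactly 1, which \<open>advance\<close> adds once.\<close>

definition carry :: com where
  "carry =
     Seq (set_var ''t'' (NMinus (var ''t'') (cur ''k'')))
    (Seq (NWrite ''k'' (var ''i'') (NNum 0))
         (incr ''i''))"

text \<open>Increments the mixed-radix counter \<open>k\<close>; \<open>c\<close> is its code and \<open>t\<close> the sum of its digits.\<close>

definition advance :: com where
  "advance =
     Seq (set_var ''i'' (NNum 0))
    (Seq (While (BNot (NLess (cur ''k'') (cur ''len''))) carry)
         (Seq (NWrite ''k'' (var ''i'') (NPlus (cur ''k'') (NNum 1))) (Seq (incr ''t'') (incr ''c''))))"

text \<open>The job considered is a leaf exactly if \<open>k[i]\<close> equals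
  \<open>len[i]\<close>; then the squared slot is added. A zero in \<open>ch\<close> plays the role
  of an infinite initial value in \<open>M\<close>.\<close>

definition relax :: com where
  "relax =
     Seq (RWrite ''x'' (NNum 0)
           (RPlus (RRead ''M'' (NMinus (var ''c'') (cur ''str'')))
             (RTimes (RRead ''w'' (NPlus (cur ''off'') (NMinus (cur ''k'') (NNum 1))))
                     (RRead ''R'' (var ''t'')))))
    (Seq (Cond (NLess (cur ''k'') (cur ''len'')) Skip
           (RWrite ''x'' (NNum 0)
             (RPlus (RRead ''x'' (NNum 0)) (RTimes (RRead ''R'' (var ''t'')) (RRead ''R'' (var ''t''))))))
         (Cond (BAnd (NLess (NNum 0) (NRead ''ch'' (var ''c'')))
                     (BNot (RLess (RRead ''x'' (NNum 0)) (RRead ''M'' (var ''c''))))) Skip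
           (Seq (RWrite ''M'' (var ''c'') (RRead ''x'' (NNum 0)))
                (NWrite ''ch'' (var ''c'') (NPlus (var ''i'') (NNum 1))))))"

definition relax_all :: com where
  "relax_all =
     Seq (set_var ''i'' (NNum 0))
         (While (NLess (var ''i'') (var ''n''))
           (Seq (Cond (NLess (NNum 0) (cur ''k'')) relax Skip) (incr ''i'')))"

definition fill_table :: com where
  "fill_table =
     While (NLess (NPlus (var ''c'') (NNum 1)) (NRead ''str'' (var ''n''))) (Seq advance relax_all)"

text \<open>\<open>k[i]\<close> is lowered before the write, so that it is the 0-based index of the
  job receiving slot \<open>t\<close>.\<close>

definition emit :: com where
  "emit =
     Seq (set_var ''i'' (NMinus (NRead ''ch'' (var ''c'')) (NNum 1)))
    (Seq (set_var ''c'' (NMinus (var ''c'') (cur ''str'')))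
    (Seq (NWrite ''k'' (var ''i'') (NMinus (cur ''k'') (NNum 1)))
    (Seq (NWrite ''S'' (NPlus (cur ''off'') (cur ''k'')) (var ''t''))
         (set_var ''t'' (NMinus (var ''t'') (NNum 1))))))"

definition backtrack :: com where
  "backtrack = While (NLess (NNum 0) (var ''t'')) emit"

definition min_wcs_program :: com where
  "min_wcs_program = Seq setup_tables (Seq fill_table backtrack)"


section \<open>Correctness and running time\<close>

context min_wcs
begin

section \<open>Setup of strides, offsets and the embedding of naturals into reals\<close>

definition input_ok :: "state \<Rightarrow> bool" where
  "input_ok s \<longleftrightarrow> nmem s ''n'' 0 = n \<and> (\<forall>i<n. nmem s ''len'' i = L i) \<and>
     (\<forall>i<n. \<forall>j<L i. rmem s ''w'' (offset i + j) = cs ! i ! j)"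

definition tables_upto :: "nat \<Rightarrow> state \<Rightarrow> bool" where
  "tables_upto m s \<longleftrightarrow> input_ok s \<and>
     (\<forall>i\<le>m. nmem s ''str'' i = stride i \<and> nmem s ''off'' i = offset i) \<and>
     (\<forall>v\<le>offset m. rmem s ''R'' v = real v)"

definition fresh :: "state \<Rightarrow> bool" where
  "fresh s \<longleftrightarrow> nmem s ''k'' = (\<lambda>_. 0) \<and> nmem s ''ch'' = (\<lambda>_. 0) \<and> rmem s ''M'' 0 = 0 \<and>
     nmem s ''t'' 0 = 0 \<and> nmem s ''c'' 0 = 0"

lemma input_ok_input_state: "input_ok (input_state cs)"
  using nth_concat_offset[of _ cs] by (simp add: input_ok_def input_state_def offset_def)

lemma setup_chain_correct:
  assumes "tables_upto m s" "fresh s" "nmem s ''i'' 0 = m" "m < n"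
  shows "runs_in setup_chain (200 * num_jobs cs) s
    (\<lambda>s'. tables_upto (Suc m) s' \<and> fresh s' \<and> nmem s' ''i'' 0 = Suc m)"
proof -
  \<comment> \<open>After \<open>j\<close> jobs of chain \<open>m\<close> the next stride has been
    summed up to \<open>Suc j\<close> copies, and \<open>R\<close> reaches just as far as the next
    offset.\<close>
  define I where "I s' \<longleftrightarrow> tables_upto m s' \<and> fresh s' \<and> nmem s' ''i'' 0 = m \<and> nmem s' ''j'' 0 \<le> L m \<and>
      nmem s' ''str'' (Suc m) = stride m * Suc (nmem s' ''j'' 0) \<and>
      nmem s' ''off'' (Suc m) = offset m + nmem s' ''j'' 0 \<and>
      (\<forall>v \<le> offset m + nmem s' ''j'' 0. rmem s' ''R'' v = real v)" for s'
  have L_le: "L m \<le> num_jobs cs"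
    using offset_mono[of "Suc m" n] \<open>m < n\<close> by (simp add: num_jobs_offset)
  have "runs_in setup_chain (40 + (Suc (num_jobs cs) * 70 + 10)) s
    (\<lambda>s'. tables_upto (Suc m) s' \<and> fresh s' \<and> nmem s' ''i'' 0 = Suc m)"
    unfolding setup_chain_def
  proof (rule runs_in_Seq[where R = I], goal_cases)
    case 1
    show ?case
      by (rule runs_in_loop_free)
        (use assms in \<open>auto simp: I_def tables_upto_def input_ok_def fresh_def\<close>)
  next
    case (2 s1)
    show ?case
    proof (rule runs_in_Seq[where R = "\<lambda>s'. I s' \<and> nmem s' ''j'' 0 = L m"])
      show "runs_in (While (NLess (var ''j'') (cur ''len'')) setup_job) (Suc (num_jobs cs) * 70) s1
          (\<lambda>s'. I s' \<and> nmem s' ''j'' 0 = L m)"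
        using 2
      proof (rule runs_in_While_bound[where variant = "\<lambda>s'. L m - nmem s' ''j'' 0" and B = 60])
        show "L m - nmem s1 ''j'' 0 \<le> num_jobs cs" using L_le by simp
      next
        fix s2 assume "I s2" "bval (NLess (var ''j'') (cur ''len'')) s2"
        then show "runs_in setup_job 60 s2
            (\<lambda>s'. I s' \<and> L m - nmem s' ''j'' 0 < L m - nmem s2 ''j'' 0)"
          unfolding setup_job_def using \<open>m < n\<close>
          by (intro runs_in_loop_free)
            (auto simp: I_def tables_upto_def input_ok_def fresh_def le_Suc_eq)
      qed (use \<open>m < n\<close> in \<open>auto simp: I_def tables_upto_def input_ok_def\<close>)
    next
      fix s1 assume "I s1 \<and> nmem s1 ''j'' 0 = L m"
      then show "runs_in (incr ''i'') 10 s1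
          (\<lambda>s'. tables_upto (Suc m) s' \<and> fresh s' \<and> nmem s' ''i'' 0 = Suc m)"
        by (intro runs_in_loop_free)
          (auto simp: I_def tables_upto_def input_ok_def fresh_def le_Suc_eq)
    qed
  qed
  then show ?thesis
    by (rule runs_in_weaken) (use num_jobs_pos in auto)
qed

text \<open>Every chain is charged time linear in \<open>num_jobs cs\<close>. This is crude, but the
  factor \<open>n\<close> is at most \<open>stride n\<close>.\<close>

lemma setup_tables_correct:
  "runs_in setup_tables (10 + Suc n * (250 * num_jobs cs)) (input_state cs)
     (\<lambda>s. tables_upto n s \<and> fresh s)"
  unfolding setup_tables_def
proof (rule runs_in_Seq)
  let ?I = "\<lambda>s. nmem s ''i'' 0 \<le> n \<and> tables_upto (nmem s ''i'' 0) s \<and> fresh s"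
  show "runs_in (NWrite ''str'' (NNum 0) (NNum 1)) 10 (input_state cs) ?I"
    by (rule runs_in_loop_free)
      (use input_ok_input_state in \<open>auto simp: tables_upto_def fresh_def input_ok_def input_state_def\<close>)
  fix s assume "?I s"
  then show "runs_in (While (NLess (var ''i'') (var ''n'')) setup_chain)
      (Suc n * (250 * num_jobs cs)) s (\<lambda>s. tables_upto n s \<and> fresh s)"
  proof (rule runs_in_While_bound[where variant = "\<lambda>s. n - nmem s ''i'' 0" and B = "200 * num_jobs cs"])
    show "1 + bcost (NLess (var ''i'') (var ''n'')) + 200 * num_jobs cs \<le> 250 * num_jobs cs"
      using num_jobs_pos by simp
  next
    fix s assume s: "?I s" "bval (NLess (var ''i'') (var ''n'')) s"
    then have "nmem s ''i'' 0 < n" by (simp add: tables_upto_def input_ok_def)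
    with s show "runs_in setup_chain (200 * num_jobs cs) s
        (\<lambda>s'. ?I s' \<and> n - nmem s' ''i'' 0 < n - nmem s ''i'' 0)"
      by (intro runs_in_weaken[OF setup_chain_correct[of "nmem s ''i'' 0"]]) auto
  qed (auto simp: tables_upto_def input_ok_def)
qed

section \<open>Filling the table\<close>

definition synced :: "state \<Rightarrow> bool" where
  "synced s \<longleftrightarrow> tables_upto n s \<and> valid (nmem s ''k'') \<and> code (nmem s ''k'') = nmem s ''c'' 0 \<and>
     weight (nmem s ''k'') = nmem s ''t'' 0"

lemma advance_correct:
  assumes "synced s" "Suc (nmem s ''c'' 0) < stride n"
    and tab: "tabulated (rmem s ''M'') (nmem s ''ch'') (nmem s ''c'' 0)"
  shows "runs_in advance (150 * n) s (\<lambda>s'. synced s' \<and> nmem s' ''c'' 0 = Suc (nmem s ''c'' 0) \<and>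
      tabulated (rmem s' ''M'') (nmem s' ''ch'') (nmem s ''c'' 0))"
proof -
  define c where "c = nmem s ''c'' 0"
  \<comment> \<open>The sum of \<open>code k\<close> and the current stride is invariant: resetting
    a full digit removes \<open>L i * stride i\<close>, exactly the amount by which the next stride
    is larger.\<close>
  define I where "I s' \<longleftrightarrow> tables_upto n s' \<and> nmem s' ''c'' 0 = c \<and>
      tabulated (rmem s' ''M'') (nmem s' ''ch'') c \<and> valid (nmem s' ''k'') \<and>
      weight (nmem s' ''k'') = nmem s' ''t'' 0 \<and> nmem s' ''i'' 0 \<le> n \<and>
      code (nmem s' ''k'') + stride (nmem s' ''i'' 0) = Suc c" for s'
  define Q where "Q s' \<longleftrightarrow> synced s' \<and> nmem s' ''c'' 0 = Suc c \<and>
      tabulated (rmem s' ''M'') (nmem s' ''ch'') c" for s'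
  \<comment> \<open>At \<open>i = n\<close> the invariant would give
    \<open>stride n \<le> Suc c\<close>, against the assumption; the carry therefore stops at a
    digit that is not full.\<close>
  have i_less: "nmem s' ''i'' 0 < n" if "I s'" for s'
    using that assms(2) c_def unfolding I_def by (cases "nmem s' ''i'' 0 = n") auto
  have "runs_in advance (10 + (Suc n * 50 + 30)) s Q"
    unfolding advance_def
  proof (rule runs_in_Seq[where R = I], goal_cases)
    case 1
    show ?case
      by (rule runs_in_loop_free)
        (use assms c_def in \<open>auto simp: I_def synced_def tables_upto_def input_ok_def\<close>)
  next
    case (2 s1)
    show ?case
    proof (rule runs_in_Seq[where R = "\<lambda>s'. I s' \<and> nmem s' ''k'' (nmem s' ''i'' 0) < L (nmem s' ''i'' 0)"],
        goal_cases)
      case 1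
      show ?case using 2
      proof (rule runs_in_While_bound[where variant = "\<lambda>s'. n - nmem s' ''i'' 0" and B = 40], goal_cases)
        case (3 s2)
        define k where "k = nmem s2 ''k''"
        define i where "i = nmem s2 ''i'' 0"
        have i: "i < n" using i_less[OF 3(1)] by (simp add: i_def)
        have "k i = L i"
          using 3 i by (force simp: I_def k_def i_def valid_def tables_upto_def input_ok_def)
        then have "valid (k(i := 0))" "weight (k(i := 0)) = nmem s2 ''t'' 0 - k i"
          "code (k(i := 0)) + stride (Suc i) = Suc c"
          using 3(1) code_upd[OF i, of k 0] weight_upd[OF i, of k 0]
          by (auto simp: I_def k_def i_def valid_def mult.commute)
        then show ?case
          unfolding carry_def using 3(1) i
          by (intro runs_in_loop_free)
            (auto simp: I_def tables_upto_def input_ok_def k_def i_def)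
      next
        case (4 s2)
        then show ?case using i_less[of s2] by (simp add: I_def tables_upto_def input_ok_def)
      qed auto
    next
      case (2 s2)
      define k where "k = nmem s2 ''k''"
      define i where "i = nmem s2 ''i'' 0"
      have i: "i < n" using i_less[of s2] 2 by (simp add: i_def)
      have "valid (k(i := Suc (k i)))" "weight (k(i := Suc (k i))) = Suc (nmem s2 ''t'' 0)"
        "code (k(i := Suc (k i))) = Suc c"
        using 2 code_upd[OF i, of k "Suc (k i)"] weight_upd[OF i, of k "Suc (k i)"]
        by (auto simp: I_def k_def i_def valid_def)
      then show ?case
        using 2 i
        by (intro runs_in_loop_free)
          (auto simp: I_def Q_def synced_def tables_upto_def input_ok_def k_def i_def)
    qed
  qed
  then show ?thesis
    by (rule runs_in_weaken) (use n_pos in \<open>auto simp: Q_def c_def Suc_le_eq[symmetric]\<close>)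
qed

text \<open>Translates the straight-line code into one comparison with the candidate
  \<open>extend V k i\<close>; the last two claims say which arrays survive.\<close>

lemma relax_run:
  fixes s :: state
  defines "i \<equiv> nmem s ''i'' 0" and "k \<equiv> nmem s ''k''" and "V \<equiv> rmem s ''M''" and "c \<equiv> nmem s ''c'' 0"
    and "ch \<equiv> nmem s ''ch''"
  assumes "synced s" "i < n" "0 < k i"
  shows "rmem (run relax s) ''M'' =
        (if 0 < ch c \<and> V c \<le> extend V k i then V else V(c := extend V k i))" (is ?M)
    and "nmem (run relax s) ''ch'' =
        (if 0 < ch c \<and> V c \<le> extend V k i then ch else ch(c := Suc i))" (is ?ch)
    and "x \<noteq> ''ch'' \<Longrightarrow> nmem (run relax s) x = nmem s x" (is "_ \<Longrightarrow> ?n")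
    and "y \<noteq> ''M'' \<Longrightarrow> y \<noteq> ''x'' \<Longrightarrow> rmem (run relax s) y = rmem s y" (is "_ \<Longrightarrow> _ \<Longrightarrow> ?r")
proof -
  have k_le: "k i \<le> L i" using assms by (simp add: synced_def valid_def)
  have R: "rmem s ''R'' (nmem s ''t'' 0) = real (weight k)"
    using assms weight_le[of k] by (simp add: synced_def tables_upto_def num_jobs_offset)
  have w: "rmem s ''w'' (nmem s ''off'' i + (k i - Suc 0)) = cs ! i ! (k i - Suc 0)"
  proof -
    have "nmem s ''off'' i = offset i" "\<And>j. j < L i \<Longrightarrow> rmem s ''w'' (offset i + j) = cs ! i ! j"
      using assms by (simp_all add: synced_def tables_upto_def input_ok_def)
    moreover have "k i - Suc 0 < L i" using assms(8) k_le by linarith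
    ultimately show ?thesis by metis
  qed
  have "nmem s ''str'' i = stride i" "nmem s ''len'' i = L i" "code k = c"
    using assms by (simp_all add: synced_def tables_upto_def input_ok_def)
  \<comment> \<open>The machine's leaf test agrees with the one in \<open>cost\<close>, because
    \<open>k i\<close> is positive and the subtraction does not truncate.\<close>
  moreover have "k i < L i \<longleftrightarrow> Suc (k i - Suc 0) \<noteq> L i" using k_le assms by auto
  ultimately have
    "extend V k i = V (c - nmem s ''str'' i) +
       rmem s ''w'' (nmem s ''off'' i + (k i - Suc 0)) * rmem s ''R'' (nmem s ''t'' 0) +
       (if k i < nmem s ''len'' i then 0 else rmem s ''R'' (nmem s ''t'' 0) * rmem s ''R'' (nmem s ''t'' 0))"
    using R w by (simp add: extend_def cost_def)
  note x = this[unfolded i_def k_def V_def c_def]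
  show ?M ?ch
    unfolding i_def k_def V_def c_def ch_def x by (simp_all add: relax_def not_less)
  show ?n if "x \<noteq> ''ch''" using that by (simp add: relax_def)
  show ?r if "y \<noteq> ''M''" "y \<noteq> ''x''" using that by (simp add: relax_def)
qed

text \<open>Invariant of the loop over chains: the entry is the minimum of the candidates from
  chains below \<open>m\<close>, attained at the recorded chain. As long as the choice is 0 there is
  no such candidate and the stored value means nothing.\<close>

definition best_upto :: "(nat \<Rightarrow> real) \<Rightarrow> (nat \<Rightarrow> nat) \<Rightarrow> (nat \<Rightarrow> nat) \<Rightarrow> nat \<Rightarrow> bool" where
  "best_upto V ch k m \<longleftrightarrow>
     (\<forall>i<m. 0 < k i \<longrightarrow> 0 < ch (code k) \<and> V (code k) \<le> extend V k i) \<and>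
     (0 < ch (code k) \<longrightarrow> (\<exists>i<m. ch (code k) = Suc i \<and> 0 < k i \<and> V (code k) = extend V k i))"

text \<open>Differs from \<open>tabulated\<close> in leaving open the entry \<open>c\<close> that is
  under construction.\<close>

definition tabulated_below :: "(nat \<Rightarrow> real) \<Rightarrow> (nat \<Rightarrow> nat) \<Rightarrow> nat \<Rightarrow> bool" where
  "tabulated_below V ch c \<longleftrightarrow> V 0 = 0 \<and>
     (\<forall>k. valid k \<and> 0 < code k \<and> code k < c \<longrightarrow> bellman V ch k) \<and> (\<forall>a>c. ch a = 0)"

lemma best_upto_Suc:
  assumes "best_upto V ch k m" "m < n" "0 < k m" "c = code k"
    and "0 < ch c \<and> V c \<le> extend V k m \<Longrightarrow> V' = V \<and> ch' = ch"
    and "\<not> (0 < ch c \<and> V c \<le> extend V k m) \<Longrightarrow> V' = V(c := extend V k m) \<and> ch' = ch(c := Suc m)"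
  shows "best_upto V' ch' k (Suc m)"
proof (cases "0 < ch c \<and> V c \<le> extend V k m")
  case True
  then show ?thesis using assms unfolding best_upto_def by (auto simp: less_Suc_eq)
next
  case False
  \<comment> \<open>The new minimum is stored at \<open>code k\<close>, which no candidate
    reads.\<close>
  have eq: "extend V' k i = extend V k i" if "i < n" "0 < k i" for i
    using assms(4,6) False by (intro extend_cong that) auto
  have "V' c \<le> extend V' k i" if "i < Suc m" "0 < k i" for i
    using assms that False eq[of i] unfolding best_upto_def by (force simp: less_Suc_eq)
  moreover have "V' c = extend V' k m" "ch' c = Suc m"
    using assms False eq[of m] by auto
  ultimately show ?thesis using assms(3,4) unfolding best_upto_def by auto
qed

lemma tabulated_below_upd:
  assumes "tabulated_below V ch c" "0 < c"
    and "\<And>a. a \<noteq> c \<Longrightarrow> V' a = V a \<and> ch' a = ch a"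
  shows "tabulated_below V' ch' c"
proof -
  have "bellman V' ch' k" if "valid k" "0 < code k" "code k < c" for k
    using that assms by (intro bellman_cong[of k V V' ch ch']) (auto simp: tabulated_below_def)
  then show ?thesis using assms by (auto simp: tabulated_below_def)
qed

lemma tabulated_from_best:
  assumes below: "tabulated_below V ch (code k)" and best: "best_upto V ch k n"
    and k: "valid k" "0 < code k"
  shows "tabulated V ch (code k)"
proof -
  \<comment> \<open>Some digit is positive, so at least one candidate exists and a choice has been
    recorded.\<close>
  have "weight k \<noteq> 0" using k(2) code_eq_0_iff[of k] by simp
  then obtain i where "i < n" "0 < k i" by (auto simp: weight_def)
  then have bell: "bellman V ch k" using best by (auto simp: best_upto_def bellman_def)
  \<comment> \<open>Vectors are functions on all naturals, so many share a code; valid ones with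
    equal codes agree below \<open>n\<close>, and only these digits matter.\<close>
  have "bellman V ch k'" if "valid k'" "code k' = code k" for k'
  proof -
    have digits: "k' i = k i" if "i < n" for i
      using code_inject[OF \<open>valid k'\<close> k(1) \<open>code k' = code k\<close> that] .
    then have "extend V k' i = extend V k i" if "i < n" for i
      using that \<open>code k' = code k\<close> weight_cong[of k' k] by (simp add: extend_def)
    with digits bell show ?thesis using \<open>code k' = code k\<close> unfolding bellman_def by auto
  qed
  then show ?thesis using below unfolding tabulated_def tabulated_below_def
    by (metis le_neq_implies_less)
qed

lemma relax_all_correct:
  assumes "synced s" "nmem s ''c'' 0 = Suc c"
    and tab: "tabulated (rmem s ''M'') (nmem s ''ch'') c"
  shows "runs_in relax_all (410 * n) s (\<lambda>s'. synced s' \<and> nmem s' ''c'' 0 = Suc c \<and>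
      tabulated (rmem s' ''M'') (nmem s' ''ch'') (Suc c))"
proof -
  define I where "I s' \<longleftrightarrow> synced s' \<and> nmem s' ''c'' 0 = Suc c \<and> nmem s' ''i'' 0 \<le> n \<and>
      tabulated_below (rmem s' ''M'') (nmem s' ''ch'') (Suc c) \<and>
      best_upto (rmem s' ''M'') (nmem s' ''ch'') (nmem s' ''k'') (nmem s' ''i'' 0)" for s'
  have "runs_in relax_all (10 + Suc n * 200) s (\<lambda>s'. synced s' \<and> nmem s' ''c'' 0 = Suc c \<and>
      tabulated (rmem s' ''M'') (nmem s' ''ch'') (Suc c))"
    unfolding relax_all_def
  proof (rule runs_in_Seq[where R = I], goal_cases)
    case 1
    show ?case
      by (rule runs_in_loop_free)
        (use assms in \<open>auto simp: I_def synced_def tables_upto_def input_ok_def tabulated_def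
          tabulated_below_def best_upto_def\<close>)
  next
    case (2 s1)
    then show ?case
    proof (rule runs_in_While_bound[where variant = "\<lambda>s'. n - nmem s' ''i'' 0" and B = 180], goal_cases)
      case (3 s2)
      define i where "i = nmem s2 ''i'' 0"
      define k where "k = nmem s2 ''k''"
      have i: "i < n" using 3 by (simp add: I_def synced_def tables_upto_def input_ok_def i_def)
      have inv: "synced s2" "code k = Suc c" "nmem s2 ''c'' 0 = Suc c"
        "tabulated_below (rmem s2 ''M'') (nmem s2 ''ch'') (Suc c)"
        "best_upto (rmem s2 ''M'') (nmem s2 ''ch'') k i"
        using 3(1) by (auto simp: I_def synced_def i_def k_def)
      show ?case
      proof (rule runs_in_loop_free, goal_cases)
        case 3
        show ?case
        proof (cases "0 < k i")
          case True
          note r = relax_run[OF inv(1), folded i_def k_def, OF i True]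
          have "best_upto (rmem (run relax s2) ''M'') (nmem (run relax s2) ''ch'') k (Suc i)"
            by (rule best_upto_Suc[OF inv(5) i True inv(2)[symmetric]]) (auto simp: r inv)
          moreover have "tabulated_below (rmem (run relax s2) ''M'') (nmem (run relax s2) ''ch'') (Suc c)"
            by (rule tabulated_below_upd[OF inv(4)]) (auto simp: r inv)
          moreover have "nmem (run relax s2) ''k'' = k" "nmem (run relax s2) ''i'' 0 = i"
            by (simp_all add: r(3) k_def i_def)
          ultimately show ?thesis
            using True inv(1-3) i r(3,4)
            by (simp add: I_def synced_def tables_upto_def input_ok_def i_def[symmetric] k_def[symmetric])
        next
          case False
          then have "best_upto (rmem s2 ''M'') (nmem s2 ''ch'') k (Suc i)"
            using inv(5) by (auto simp: best_upto_def less_Suc_eq)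
          then show ?thesis
            using False inv i
            by (simp add: I_def synced_def tables_upto_def input_ok_def i_def[symmetric] k_def[symmetric])
        qed
      qed (simp_all add: relax_def)
    next
      case (4 s2)
      then have "nmem s2 ''i'' 0 = n" by (simp add: I_def synced_def tables_upto_def input_ok_def)
      then show ?case
        using 4(1) tabulated_from_best[of "rmem s2 ''M''" "nmem s2 ''ch''" "nmem s2 ''k''"]
        by (simp add: I_def synced_def)
    qed auto
  qed
  then show ?thesis
    by (rule runs_in_weaken) (use n_pos in \<open>auto simp: Suc_le_eq[symmetric]\<close>)
qed

lemma fill_table_correct:
  assumes "tables_upto n s" "fresh s"
  shows "runs_in fill_table (Suc (stride n) * (600 * n)) s (\<lambda>s'. synced s' \<and>
      nmem s' ''c'' 0 = code L \<and> tabulated (rmem s' ''M'') (nmem s' ''ch'') (code L))"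
proof -
  define I where "I s' \<longleftrightarrow> synced s' \<and> tabulated (rmem s' ''M'') (nmem s' ''ch'') (nmem s' ''c'' 0)" for s'
  have "code (\<lambda>_. 0) = 0" "weight (\<lambda>_. 0) = 0" by (simp_all add: code_def weight_def)
  then have init: "I s"
    using assms by (auto simp: I_def synced_def fresh_def valid_def tabulated_def)
  show ?thesis
    unfolding fill_table_def
  proof (rule runs_in_While_bound[where I = I and variant = "\<lambda>s'. stride n - nmem s' ''c'' 0"
        and B = "150 * n + 410 * n"], goal_cases)
    case (4 s1)
    have guard: "Suc (nmem s1 ''c'' 0) < stride n"
      using 4 by (simp add: I_def synced_def tables_upto_def input_ok_def)
    show ?case
    proof (rule runs_in_Seq[OF advance_correct], goal_cases)
      case (4 s2)
      then show ?case using guard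
        by (intro runs_in_weaken[OF relax_all_correct[of s2 "nmem s1 ''c'' 0"]])
          (auto simp: I_def)
    qed (use 4 guard in \<open>auto simp: I_def\<close>)
  next
    case (5 s1)
    \<comment> \<open>The failed guard bounds \<open>c\<close> from below and validity of the
      counter from above, leaving only the last code.\<close>
    then have "nmem s1 ''c'' 0 < stride n" "stride n \<le> Suc (nmem s1 ''c'' 0)"
      using code_less[of "nmem s1 ''k''"]
      by (auto simp: I_def synced_def tables_upto_def input_ok_def)
    then have "nmem s1 ''c'' 0 = code L" using code_full by linarith
    then show ?case using 5 by (auto simp: I_def)
  qed (use init n_pos in \<open>auto simp: Suc_le_eq[symmetric]\<close>)
qed

section \<open>Reading off an optimal schedule\<close>

text \<open>Invariant of the backward pass: the placed jobs fill the slots above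
  \<open>weight k\<close>, and the cost already paid plus the table value of the remaining prefix is
  the claimed optimum. Injectivity is left to a final count.\<close>

definition schedules_suffix :: "(nat \<Rightarrow> real) \<Rightarrow> (job \<Rightarrow> nat) \<Rightarrow> (nat \<Rightarrow> nat) \<Rightarrow> bool" where
  "schedules_suffix V S k \<longleftrightarrow>
     S ` suffix k = {weight k<..num_jobs cs} \<and>
     (\<forall>i<n. \<forall>j j'. k i \<le> j \<and> j < j' \<and> j' < L i \<longrightarrow> S (i, j) < S (i, j')) \<and>
     V (code k) + (\<Sum>p\<in>suffix k. cost p (S p)) = V (code L)"

text \<open>The added job gets a slot below all occupied ones, so the order in its chain is kept;
  the attained Bellman equation moves its cost from the table value into the sum.\<close>

lemma schedules_suffix_decrement:
  assumes "schedules_suffix V S k" "valid k" and i: "i < n" "0 < k i"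
    and V: "V (code k) = extend V k i"
    and S': "\<And>p. p \<in> suffix k \<Longrightarrow> S' p = S p" "S' (i, k i - 1) = weight k"
  shows "schedules_suffix V S' (k(i := k i - 1))"
proof -
  define k' where "k' = k(i := k i - 1)"
  note suf = suffix_decrement[of i k, OF i \<open>valid k\<close>, folded k'_def]
  have wt: "weight k = Suc (weight k')" using weight_decrement[of i k, OF i] by (simp add: k'_def)
  have img: "S' ` suffix k = {weight k<..num_jobs cs}"
    using assms(1) S'(1) by (simp add: schedules_suffix_def cong: image_cong_simp)
  have "S' ` suffix k' = {weight k'<..num_jobs cs}"
    using img S'(2) wt weight_le[OF \<open>valid k\<close>] unfolding suf(1) by auto
  moreover have "S' (l, j) < S' (l, j')" if "l < n" "k' l \<le> j" "j < j'" "j' < L l" for l j j'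
  proof (cases "(l, j) = (i, k i - 1)")
    case True
    then have "(l, j') \<in> suffix k" using that by (auto simp: suffix_def)
    then have "weight k < S' (l, j')" using img by fastforce
    then show ?thesis using True S'(2) by simp
  next
    case False
    then have "k l \<le> j" using that by (auto simp: k'_def split: if_splits)
    then have "(l, j) \<in> suffix k" "(l, j') \<in> suffix k" "S (l, j) < S (l, j')"
      using that assms(1) by (auto simp: suffix_def schedules_suffix_def)
    then show ?thesis using S'(1) by simp
  qed
  moreover have "V (code k') + (\<Sum>p\<in>suffix k'. cost p (S' p)) = V (code L)"
  proof -
    have "(\<Sum>p\<in>suffix k'. cost p (S' p)) = cost (i, k i - 1) (weight k) + (\<Sum>p\<in>suffix k. cost p (S p))"
      unfolding suf(1) using suf(2) S' finite_suffix by simp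
    moreover have "V (code k) = V (code k') + cost (i, k i - 1) (weight k)"
      using V code_decrement[of i k, OF i] by (simp add: extend_def k'_def)
    ultimately show ?thesis using assms(1) by (simp add: schedules_suffix_def)
  qed
  ultimately show ?thesis unfolding schedules_suffix_def k'_def[symmetric] by blast
qed

text \<open>With nothing left, the schedule costs exactly \<open>V (code L)\<close>, which
  \<open>table_lower_bound\<close> shows to be a lower bound for every feasible schedule.\<close>

lemma optimal_scheduleI:
  assumes tab: "tabulated V ch (code L)" and S: "schedules_suffix V S k" and k: "weight k = 0"
  shows "optimal_schedule cs S"
proof -
  have k0: "k i = 0" if "i < n" for i using k that by (simp add: weight_def)
  then have suf: "suffix k = jobs cs" by (auto simp: suffix_def jobs_def)
  then have img: "S ` jobs cs = {1..num_jobs cs}"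
    using S k by (auto simp: schedules_suffix_def)
  \<comment> \<open>A map onto a set of the same finite cardinality is injective.\<close>
  moreover have "inj_on S (jobs cs)"
    using img card_jobs finite_prefix[of L] by (intro eq_card_imp_inj_on) (auto simp: jobs_eq_prefix)
  ultimately have feas: "feasible cs S"
    using S k0 by (auto simp: feasible_def bij_betw_def schedules_suffix_def)
  have "code k = 0" using k code_eq_0_iff by simp
  then have wcs: "wcs cs S = V (code L)"
    using S tab by (simp add: schedules_suffix_def tabulated_def wcs_eq_sum_cost suf)
  have "wcs cs S \<le> wcs cs S'" if "feasible cs S'" for S'
    unfolding wcs using table_lower_bound[OF tab, of L S'] that
    by (auto simp: wcs_eq_sum_cost jobs_eq_prefix feasible_def valid_def weight_full)
  then show ?thesis
    using feas by (auto simp: optimal_schedule_def is_arg_min_def not_less)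
qed

lemma backtrack_correct:
  assumes "synced s" "nmem s ''c'' 0 = code L" "tabulated (rmem s ''M'') (nmem s ''ch'') (code L)"
  shows "runs_in backtrack (Suc (num_jobs cs) * 70) s
    (\<lambda>s'. optimal_schedule cs (output_schedule cs s'))"
proof -
  define I where "I s' \<longleftrightarrow> synced s' \<and> tabulated (rmem s' ''M'') (nmem s' ''ch'') (code L) \<and>
      schedules_suffix (rmem s' ''M'') (output_schedule cs s') (nmem s' ''k'')" for s'
  have "valid L" by (simp add: valid_def)
  \<comment> \<open>The counter stands at the last code, which by injectivity of codes makes it the
    full vector.\<close>
  have k: "nmem s ''k'' i = L i" if "i < n" for i
    using code_inject[OF _ \<open>valid L\<close> _ that] assms by (simp add: synced_def)
  then have "suffix (nmem s ''k'') = {}" "weight (nmem s ''k'') = num_jobs cs"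
    using weight_cong[of "nmem s ''k''" L] weight_full by (auto simp: suffix_def)
  then have init: "I s"
    using assms k by (auto simp: I_def schedules_suffix_def synced_def)
  show ?thesis
    unfolding backtrack_def
  proof (rule runs_in_While_bound[where I = I and variant = "\<lambda>s'. nmem s' ''t'' 0" and B = 60], goal_cases)
    case 2
    show ?case using init weight_le[of "nmem s ''k''"] by (auto simp: I_def synced_def)
  next
    case (4 s1)
    define k where "k = nmem s1 ''k''"
    define V where "V = rmem s1 ''M''"
    have inv: "tables_upto n s1" "valid k" "code k = nmem s1 ''c'' 0" "weight k = nmem s1 ''t'' 0"
      "tabulated V (nmem s1 ''ch'') (code L)" "schedules_suffix V (output_schedule cs s1) k"
      "0 < nmem s1 ''t'' 0"
      using 4 by (auto simp: I_def synced_def k_def V_def)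
    have "bellman V (nmem s1 ''ch'') k"
      using inv code_eq_0_iff[of k] code_less[of k] code_full by (auto simp: tabulated_def)
    then obtain i where i: "i < n" "nmem s1 ''ch'' (nmem s1 ''c'' 0) = Suc i" "0 < k i"
      "V (code k) = extend V k i"
      using inv(3) by (auto simp: bellman_def)
    have tabs: "nmem s1 ''str'' i = stride i" "nmem s1 ''off'' i = offset i"
      using inv(1) i(1) by (auto simp: tables_upto_def)
    define k' where "k' = k(i := k i - 1)"
    let ?s = "run emit s1"
    have mem: "rmem ?s = rmem s1" "nmem ?s ''k'' = k'" "nmem ?s ''c'' 0 = nmem s1 ''c'' 0 - stride i"
      "nmem ?s ''t'' 0 = nmem s1 ''t'' 0 - 1" "nmem ?s ''ch'' = nmem s1 ''ch''"
      "nmem ?s ''S'' = (nmem s1 ''S'')(offset i + (k i - 1) := nmem s1 ''t'' 0)"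
      using i tabs by (simp_all add: emit_def k_def k'_def)
    have k_le: "k i - 1 < L i" using inv(2) i by (force simp: valid_def)
    have "schedules_suffix V (output_schedule cs ?s) k'"
      unfolding k'_def
    proof (rule schedules_suffix_decrement[OF inv(6,2) i(1,3,4)])
      show "output_schedule cs ?s (i, k i - 1) = weight k"
        using inv(4) mem(6) by (simp add: output_schedule_def job_address_def offset_def[symmetric])
      fix p assume "p \<in> suffix k"
      then obtain l j where p: "p = (l, j)" "k l \<le> j" "j < L l" by (auto simp: suffix_def)
      \<comment> \<open>Distinct jobs have distinct addresses, so slots written earlier are not
        overwritten.\<close>
      then have "offset l + j \<noteq> offset i + (k i - 1)"
        using offset_add_inject[OF p(3) k_le] i(3) by auto
      then show "output_schedule cs ?s p = output_schedule cs s1 p"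
        using mem(6) p(1) by (simp add: output_schedule_def job_address_def offset_def[symmetric])
    qed
    moreover have "synced ?s"
      using inv(1-4) i mem(1-4) code_decrement[of i k] weight_decrement[of i k] valid_decrement[of k i]
      unfolding synced_def mem k'_def
      by (auto simp: tables_upto_def input_ok_def emit_def)
    ultimately have "I ?s \<and> nmem ?s ''t'' 0 < nmem s1 ''t'' 0"
      using inv mem by (simp add: I_def V_def)
    then show ?case
      by (intro runs_in_loop_free) (auto simp: emit_def)
  next
    case (5 s1)
    then show ?case
      by (intro optimal_scheduleI[of "rmem s1 ''M''" "nmem s1 ''ch''" _ "nmem s1 ''k''"])
        (auto simp: I_def synced_def)
  qed (use init in auto)
qed

section \<open>Total running time\<close>

lemma min_wcs_program_correct:
  "runs_in min_wcs_program (3000 * (num_jobs cs * stride n)) (input_state cs)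
     (\<lambda>s. optimal_schedule cs (output_schedule cs s))"
proof (rule runs_in_weaken)
  show "runs_in min_wcs_program ((10 + Suc n * (250 * num_jobs cs)) +
      (Suc (stride n) * (600 * n) + Suc (num_jobs cs) * 70)) (input_state cs)
      (\<lambda>s. optimal_schedule cs (output_schedule cs s))"
    unfolding min_wcs_program_def
    by (intro runs_in_Seq[OF setup_tables_correct] runs_in_Seq[OF fill_table_correct] backtrack_correct)
      auto
  let ?X = "num_jobs cs * stride n"
  \<comment> \<open>The three products come from setup, table filling and backtracking;
    \<open>n\<close> is bounded by \<open>stride n\<close> in the first and by
    \<open>num_jobs cs\<close> in the second.\<close>
  have "n * num_jobs cs \<le> ?X" using n_le_stride by simp
  moreover have "stride n * n \<le> ?X" using n_le_num_jobs by simp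
  moreover have "num_jobs cs \<le> ?X" using stride_pos[of n] by simp
  moreover have "(10 + Suc n * (250 * num_jobs cs)) +
      (Suc (stride n) * (600 * n) + Suc (num_jobs cs) * 70) =
      80 + 320 * num_jobs cs + 600 * n + 250 * (n * num_jobs cs) + 600 * (stride n * n)"
    by (simp add: algebra_simps)
  ultimately show "(10 + Suc n * (250 * num_jobs cs)) +
      (Suc (stride n) * (600 * n) + Suc (num_jobs cs) * 70) \<le> 3000 * ?X"
    using num_jobs_pos n_le_num_jobs by linarith
qed

end

theorem theorem3:
  "\<exists>c time. solves_min_wcs c time \<and>
     (\<lambda>cs. real (time cs)) \<in>
       O[principal {cs. wcs_instance cs}](\<lambda>cs.
         real (num_jobs cs * (\<Prod>i<length cs. length (cs ! i) + 1)))"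
proof -
  let ?bound = "\<lambda>cs. num_jobs cs * (\<Prod>i<length cs. length (cs ! i) + 1)"
  have "\<exists>t s. exec min_wcs_program (input_state cs) t s \<and> t \<le> 3000 * ?bound cs \<and>
      optimal_schedule cs (output_schedule cs s)" if "wcs_instance cs" for cs
  proof -
    interpret min_wcs cs by unfold_locales (fact that)
    show ?thesis using min_wcs_program_correct unfolding runs_in_def stride_def .
  qed
  \<comment> \<open>The exact running time is chosen instance by instance; on other inputs
    \<open>time\<close> is unconstrained.\<close>
  then obtain time where time: "\<And>cs. wcs_instance cs \<Longrightarrow>
      \<exists>s. exec min_wcs_program (input_state cs) (time cs) s \<and> time cs \<le> 3000 * ?bound cs \<and>
        optimal_schedule cs (output_schedule cs s)"
    by metis
  then have "solves_min_wcs min_wcs_program time"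
    unfolding solves_min_wcs_def by blast
  \<comment> \<open>For a principal filter, eventually means at every instance, and 3000 works
    uniformly.\<close>
  moreover have "(\<lambda>cs. real (time cs)) \<in> O[principal {cs. wcs_instance cs}](\<lambda>cs. real (?bound cs))"
  proof (rule bigoI[where c = 3000], unfold eventually_principal, intro ballI)
    fix cs assume "cs \<in> {cs. wcs_instance cs}"
    then have "time cs \<le> 3000 * ?bound cs" using time by blast
    then have "real (time cs) \<le> real (3000 * ?bound cs)" by (rule of_nat_mono)
    then show "norm (real (time cs)) \<le> 3000 * norm (real (?bound cs))"
      by (simp del: of_nat_prod)
  qed
  ultimately show ?thesis by blast
qed

end
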